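(* Let $X$ be a real random variable with bounded density $f$, cumulative distribution function $F$ and characteristic function $\varphi(u)=E[e^{iuX}]$. Suppose there is an interval $(\alpha,\beta)\subset\overline{\mathbb{R}}$ such that $f(x)>0$ if and only if $x\in(\alpha,\beta)$, and suppose there are constants $C_1,C_2,L_0>0$ such that $$|f(x)|\leq C_1\exp(-C_2|x|)\quad\text{for all }|x|\geq L_0 .$$ Let $n\in\mathbb{N}$ be even ($n\ge 2$) and set $\mu:=E[X]$. Then there is $\varepsilon_0>0$ such that for every $\varepsilon\in(0,\varepsilon_0)$ there is $N_0\in\mathbb{N}$ such that for every $N\geq N_0$ the following holds: with $$\ell:=\sqrt[n]{\frac{2E[(X-\mu)^n]}{\varepsilon}},\quad a:=\max(\mu-\ell,\alpha),\quad b:=\min(\mu+\ell,\beta),$$ the COS approximation $H_{\text{COS}}$ of $F$ with truncation interval $(a,b)$ and number of terms $N$ satisfies $$\sup_{y\in\mathbb{R}}|H_{\text{COS}}(y)-F(y)|\leq\varepsilon .$$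
   Context: $\overline{\mathbb{R}}=\mathbb{R}\cup\{-\infty,\infty\}$, so $\alpha$ and $\beta$ may be infinite. COS approximation: given a finite interval $(a,b)\subset(\alpha,\beta)$ and $N\in\mathbb{N}$, define for $k=0,1,\dots,N$ $$c_k:=\frac{2}{b-a}\,\Re\left\{\varphi\left(\frac{k\pi}{b-a}\right)\exp\left(-i\frac{ka\pi}{b-a}\right)\right\}.$$ Define $H_{\text{COS}}(y):=0$ for $y\leq a$, and for $y>a$ $$H_{\text{COS}}(y):=\frac{c_0}{2}\big(\min(y,b)-a\big)+\sum_{k=1}^{N}c_k\frac{b-a}{k\pi}\sin\left(k\pi\frac{\min(y,b)-a}{b-a}\right).$$ *)

theory Defs
  imports "HOL-Probability.Probability"
begin

definition COS_coeff :: "(real \<Rightarrow> complex) \<Rightarrow> real \<Rightarrow> real \<Rightarrow> nat \<Rightarrow> real" where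
  "COS_coeff \<phi> a b k =
     2 / (b - a) * Re (\<phi> (real k * pi / (b - a)) *
                      exp (- \<i> * complex_of_real (real k * a * pi / (b - a))))"

definition H_COS :: "(real \<Rightarrow> complex) \<Rightarrow> real \<Rightarrow> real \<Rightarrow> nat \<Rightarrow> real \<Rightarrow> real" where
  "H_COS \<phi> a b N y =
     (if y \<le> a then 0
      else COS_coeff \<phi> a b 0 / 2 * (min y b - a)
           + (\<Sum>k=1..N. COS_coeff \<phi> a b k * ((b - a) / (real k * pi))
                          * sin (real k * pi * ((min y b - a) / (b - a)))))"

end

theory Submission
  imports Defs "HOL-Real_Asymp.Real_Asymp"
begin

text \<open>
  Exchanging the expectation with the finite cosine sum gives \<open>H_COS y = E (K\<^sub>N y X)\<close>, where the
  kernel \<open>K\<^sub>N\<close> consists of two values of the partial sums \<open>\<Sum>k\<le>N. sin (k * \<theta>) / k\<close> of the Fourier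
  series of the sawtooth. Replacing them by the sawtooth itself gives a limit kernel with values in
  \<open>{0, 1}\<close> that equals the indicator of \<open>x \<le> y\<close> for \<open>x \<in> (a, b)\<close>. Its expectation therefore
  differs from \<open>F y\<close> by at most \<open>P (X \<notin> (a, b))\<close>, which Markov's inequality for \<open>(X - \<mu>) ^ n\<close> bounds by
  \<open>\<epsilon> / 2\<close>. The remaining error is uniform in \<open>y\<close>: after a translation the density is dominated by a fixed
  integrable function, and the partial sums converge boundedly almost everywhere to the sawtooth.
\<close>

section \<open>The Fourier series of the sawtooth\<close>

definition sine_sum :: "nat \<Rightarrow> real \<Rightarrow> real" where
  "sine_sum N \<theta> = (\<Sum>k=1..N. sin (real k * \<theta>) / real k)"

text \<open>
  At multiples of \<open>2 * pi\<close> the value is \<open>pi / 2\<close> and not the sum \<open>0\<close> of the sine series; these points are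
  a null set.
\<close>

definition sawtooth :: "real \<Rightarrow> real" where
  "sawtooth \<theta> = pi / 2 - \<theta> / 2 + pi * of_int \<lfloor>\<theta> / (2 * pi)\<rfloor>"

lemma sine_sum_measurable [measurable]: "sine_sum N \<in> borel_measurable borel"
  unfolding sine_sum_def by measurable

lemma sawtooth_measurable [measurable]: "sawtooth \<in> borel_measurable borel"
  unfolding sawtooth_def by measurable

lemma sawtooth_eq:
  assumes "0 \<le> \<theta>" "\<theta> < 2 * pi"
  shows "sawtooth \<theta> = (pi - \<theta>) / 2"
proof -
  have "\<lfloor>\<theta> / (2 * pi)\<rfloor> = 0"
    using assms by (simp add: floor_eq_iff field_simps)
  then show ?thesis by (simp add: sawtooth_def field_simps)
qed

lemma sawtooth_periodic: "sawtooth (\<theta> + 2 * pi * of_int m) = sawtooth \<theta>"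
proof -
  have "(\<theta> + 2 * pi * of_int m) / (2 * pi) = \<theta> / (2 * pi) + of_int m"
    by (simp add: field_simps)
  then have "\<lfloor>(\<theta> + 2 * pi * of_int m) / (2 * pi)\<rfloor> = \<lfloor>\<theta> / (2 * pi)\<rfloor> + m"
    by (metis floor_add_int)
  then show ?thesis by (simp add: sawtooth_def field_simps)
qed

lemma sine_sum_periodic: "sine_sum N (\<theta> + 2 * pi * of_int m) = sine_sum N \<theta>"
proof -
  have "sin (real k * (\<theta> + 2 * pi * of_int m)) = sin (real k * \<theta>)" for k
  proof -
    have "real k * (\<theta> + 2 * pi * of_int m) = real k * \<theta> + of_int (int k * m) * (2 * pi)"
      by (simp add: algebra_simps)
    then show ?thesis
      using sin.plus_of_int[of "real k * \<theta>" "int k * m"] by simp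
  qed
  then show ?thesis by (simp add: sine_sum_def)
qed

lemma sine_sum_minus: "sine_sum N (- \<theta>) = - sine_sum N \<theta>"
  by (simp add: sine_sum_def sum_negf)

section \<open>Rate of convergence of the sine series\<close>

lemma Dirichlet_kernel:
  assumes "sin (\<theta> / 2) \<noteq> 0"
  shows "(\<Sum>k=1..N. cos (real k * \<theta>)) = sin ((real N + 1/2) * \<theta>) / (2 * sin (\<theta> / 2)) - 1/2"
proof (induction N)
  case 0
  then show ?case using assms by simp
next
  case (Suc N)
  \<comment> \<open>Multiplied by \<open>2 * sin (\<theta> / 2)\<close>, the new cosine is a
    difference of consecutive sines, so the sum telescopes.\<close>
  have "sin ((real (Suc N) + 1/2) * \<theta>) - sin ((real N + 1/2) * \<theta>) = 2 * sin (\<theta>/2) * cos (real (Suc N) * \<theta>)"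
    by (subst sin_diff_sin) (simp add: algebra_simps add_divide_distrib)
  then show ?case
    using Suc assms by (simp add: field_simps)
qed

text \<open>
  Integrating the Dirichlet kernel from \<open>\<theta>\<close> to \<open>pi\<close> by parts yields \<open>E\<close> below, whose derivative is
  \<open>cos ((N + 1/2) * x) * h' x\<close>; hence \<open>E - h\<close> and \<open>E + h\<close> are monotone.
\<close>

lemma sine_sum_approx:
  assumes "0 < \<theta>" "\<theta> \<le> pi"
  shows "\<bar>sine_sum N \<theta> - (pi - \<theta>) / 2\<bar> \<le> 2 / ((2 * real N + 1) * sin (\<theta> / 2))"
proof -
  \<comment> \<open>The factor is chosen so that \<open>(N + 1/2) * h x\<close> is
    \<open>1 / (2 * sin (x / 2))\<close>, the coefficient in the Dirichlet kernel.\<close>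
  define h where "h = (\<lambda>x. 1 / ((2 * real N + 1) * sin (x / 2)))"
  define h' where "h' = (\<lambda>x. - cos (x / 2) / (2 * (2 * real N + 1) * (sin (x / 2))\<^sup>2))"
  define E where "E = (\<lambda>x. sine_sum N x - (pi - x) / 2 + cos ((real N + 1/2) * x) * h x)"
  have pos: "sin (x / 2) > 0" if "\<theta> \<le> x" "x \<le> pi" for x
    using that assms by (intro sin_gt_zero) auto
  have dh: "(h has_real_derivative h' x) (at x)" if "\<theta> \<le> x" "x \<le> pi" for x
  proof -
    have "((\<lambda>x. 1 / (c * sin (x / 2))) has_real_derivative - cos (x / 2) / (2 * c * (sin (x / 2))\<^sup>2)) (at x)"
      if "c \<noteq> 0" for c :: real
      using that pos[OF \<open>\<theta> \<le> x\<close> \<open>x \<le> pi\<close>]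
      by (auto intro!: derivative_eq_intros simp: divide_simps) (simp add: power2_eq_square)
    from this[of "2 * real N + 1"] show ?thesis
      unfolding h_def h'_def by (simp add: add_nonneg_eq_0_iff)
  qed
  have ds: "((\<lambda>x. sine_sum N x) has_real_derivative (\<Sum>k=1..N. cos (real k * x))) (at x)" for x
    unfolding sine_sum_def
    by (rule DERIV_sum) (auto intro!: derivative_eq_intros)
  have dE: "(E has_real_derivative cos ((real N + 1/2) * x) * h' x) (at x)"
    if "\<theta> \<le> x" "x \<le> pi" for x
  proof -
    have "(E has_real_derivative (\<Sum>k=1..N. cos (real k * x)) + 1/2 +
        (- sin ((real N + 1/2) * x) * (real N + 1/2) * h x + cos ((real N + 1/2) * x) * h' x)) (at x)"
      unfolding E_def using dh[OF that] ds[of x]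
      by (auto intro!: derivative_eq_intros)
    moreover have "(\<Sum>k=1..N. cos (real k * x)) + 1/2 = sin ((real N + 1/2) * x) * (real N + 1/2) * h x"
      using pos[OF that] by (subst Dirichlet_kernel) (auto simp: h_def divide_simps)
    ultimately show ?thesis by simp
  qed
  have h'_le: "h' x \<le> 0" if "\<theta> \<le> x" "x \<le> pi" for x
  proof -
    have "cos (x / 2) \<ge> 0"
      using that assms by (intro cos_ge_zero) auto
    then show ?thesis by (simp add: h'_def)
  qed
  \<comment> \<open>The sine sum, the linear term and the boundary cosine all vanish at
    \<open>pi\<close>, which makes it the convenient end point.\<close>
  have Epi: "E pi = 0"
  proof -
    have "cos ((real N + 1/2) * pi) = 0"
      by (simp add: distrib_right cos_add)
    moreover have "sine_sum N pi = 0" by (simp add: sine_sum_def)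
    ultimately show ?thesis by (simp add: E_def)
  qed
  have hpos: "h x > 0" if "\<theta> \<le> x" "x \<le> pi" for x
    using pos[OF that] by (simp add: h_def add_nonneg_pos)
  have "E \<theta> - h \<theta> \<le> E pi - h pi"
  proof (rule DERIV_nonneg_imp_nondecreasing[OF assms(2)])
    fix x assume x: "\<theta> \<le> x" "x \<le> pi"
    have "((\<lambda>x. E x - h x) has_real_derivative cos ((real N + 1/2) * x) * h' x - h' x) (at x)"
      by (intro DERIV_diff dE dh x)
    moreover have "cos ((real N + 1/2) * x) * h' x - h' x = (1 - cos ((real N + 1/2) * x)) * - h' x"
      by (simp add: algebra_simps)
    moreover have "\<dots> \<ge> 0" using h'_le[OF x] by (intro mult_nonneg_nonneg) auto
    ultimately show "\<exists>y. ((\<lambda>x. E x - h x) has_real_derivative y) (at x) \<and> 0 \<le> y" by metis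
  qed
  moreover have "E \<theta> + h \<theta> \<ge> E pi + h pi"
  proof (rule DERIV_nonpos_imp_nonincreasing[OF assms(2)])
    fix x assume x: "\<theta> \<le> x" "x \<le> pi"
    have "((\<lambda>x. E x + h x) has_real_derivative cos ((real N + 1/2) * x) * h' x + h' x) (at x)"
      by (intro DERIV_add dE dh x)
    moreover have "cos ((real N + 1/2) * x) * h' x + h' x = (1 + cos ((real N + 1/2) * x)) * h' x"
      by (simp add: algebra_simps)
    moreover have "\<dots> \<le> 0"
      using h'_le[OF x] cos_ge_minus_one[of "(real N + 1/2) * x"]
      by (intro mult_nonneg_nonpos) (auto simp del: cos_ge_minus_one)
    ultimately show "\<exists>y. ((\<lambda>x. E x + h x) has_real_derivative y) (at x) \<and> y \<le> 0" by metis
  qed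
  ultimately have "\<bar>E \<theta>\<bar> \<le> h \<theta>"
    using Epi hpos[of pi] assms by auto
  \<comment> \<open>Removing the boundary term from \<open>E\<close> costs a second
    \<open>h \<theta>\<close>; hence the factor 2.\<close>
  moreover have "\<bar>cos ((real N + 1/2) * \<theta>) * h \<theta>\<bar> \<le> h \<theta>"
    using hpos[of \<theta>] assms by (simp add: abs_mult mult_left_le_one_le)
  ultimately have "\<bar>sine_sum N \<theta> - (pi - \<theta>) / 2\<bar> \<le> 2 * h \<theta>"
    unfolding E_def by linarith
  then show ?thesis by (simp add: h_def)
qed

text \<open>Jordan's inequality: the concave sine lies above its chord from \<open>0\<close> to
  \<open>pi / 2\<close>, and \<open>x / 2\<close> is the convex combination with weight
  \<open>x / pi\<close>.\<close>

lemma sin_half_ge: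
  assumes "0 \<le> x" "x \<le> pi"
  shows "x / pi \<le> sin (x / 2)"
proof -
  have "concave_on {0..pi} sin"
    by (rule f''_le0_imp_concave[where f' = cos and f'' = "\<lambda>x. - sin x"])
      (auto intro!: derivative_eq_intros sin_ge_zero)
  moreover have "x / pi \<ge> 0" "1 - x / pi \<ge> 0" "pi / 2 \<in> {0..pi}" "0 \<in> {0..pi}"
    using assms by (auto simp: field_simps)
  ultimately have "(1 - x / pi) * sin 0 + x / pi * sin (pi / 2) \<le> sin ((1 - x / pi) *\<^sub>R 0 + (x / pi) *\<^sub>R (pi / 2))"
    by (metis concave_on_iff diff_add_cancel)
  then show ?thesis by simp
qed

text \<open>Serves for small \<open>N * \<theta>\<close>, where the bound of
  \<open>sine_sum_approx\<close> blows up.\<close>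

lemma sine_sum_near_zero:
  assumes "0 \<le> \<theta>"
  shows "\<bar>sine_sum N \<theta>\<bar> \<le> real N * \<theta>"
proof -
  have "\<bar>sin (real k * \<theta>) / real k\<bar> \<le> \<theta>" if "k \<in> {1..N}" for k
  proof -
    have "\<bar>sin (real k * \<theta>)\<bar> \<le> real k * \<theta>"
      using abs_sin_x_le_abs_x[of "real k * \<theta>"] assms by simp
    then show ?thesis using that by (simp add: field_simps)
  qed
  then have "(\<Sum>k=1..N. \<bar>sin (real k * \<theta>) / real k\<bar>) \<le> (\<Sum>k=1..N. \<theta>)"
    by (rule sum_mono)
  then show ?thesis
    unfolding sine_sum_def by (intro order.trans[OF sum_abs]) simp
qed

text \<open>A crude bound that only serves integrability of the kernel for fixed
  \<open>N\<close>.\<close>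

lemma sine_sum_bounded: "\<bar>sine_sum N \<theta>\<bar> \<le> real N"
proof -
  have "\<bar>sin (real k * \<theta>) / real k\<bar> \<le> 1" if "k \<in> {1..N}" for k
  proof -
    have "\<bar>sin (real k * \<theta>)\<bar> \<le> real k"
      using that by (intro order.trans[OF abs_sin_le_one]) auto
    then show ?thesis using that by simp
  qed
  then have "(\<Sum>k=1..N. \<bar>sin (real k * \<theta>) / real k\<bar>) \<le> (\<Sum>k=1..N. 1)"
    by (rule sum_mono)
  then show ?thesis
    unfolding sine_sum_def by (intro order.trans[OF sum_abs]) simp
qed

section \<open>Bounded convergence to the sawtooth almost everywhere\<close>

definition sawtooth_error :: "nat \<Rightarrow> real \<Rightarrow> real" where
  "sawtooth_error N \<theta> = \<bar>sine_sum N \<theta> - sawtooth \<theta>\<bar>"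

lemma sawtooth_error_measurable [measurable]: "sawtooth_error N \<in> borel_measurable borel"
  unfolding sawtooth_error_def by measurable

text \<open>The overshoot at the jump stays bounded. If \<open>N * \<theta> \<le> 1\<close>, the two
  terms are at most 1 and 2. Otherwise Jordan's inequality bounds the denominator in
  \<open>sine_sum_approx\<close> below by \<open>2 / pi\<close>, so the error is at most
  \<open>pi\<close>.\<close>

lemma sawtooth_error_bounded_aux:
  assumes "0 \<le> \<theta>" "\<theta> \<le> pi"
  shows "\<bar>sine_sum N \<theta> - (pi - \<theta>) / 2\<bar> \<le> 4"
proof (cases "real N * \<theta> \<le> 1")
  case True
  have "\<bar>sine_sum N \<theta>\<bar> \<le> 1"
    using sine_sum_near_zero[OF assms(1), of N] True by linarith
  moreover have "0 \<le> (pi - \<theta>) / 2" "(pi - \<theta>) / 2 \<le> 2"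
    using assms pi_less_4 by auto
  ultimately show ?thesis by linarith
next
  case False
  then have th: "\<theta> > 0" using assms(1) by (cases "\<theta> = 0") auto
  have "(2 * real N + 1) * sin (\<theta> / 2) \<ge> (2 * real N) * (\<theta> / pi)"
    using sin_half_ge[OF assms] th assms by (intro mult_mono) auto
  moreover have "(2 * real N) * (\<theta> / pi) \<ge> 2 / pi"
    using False by (simp add: field_simps)
  ultimately have *: "(2 * real N + 1) * sin (\<theta> / 2) \<ge> 2 / pi" by linarith
  have "0 < (2 * real N + 1) * sin (\<theta> / 2)"
    using * by (rule less_le_trans[rotated]) simp
  then have "2 / ((2 * real N + 1) * sin (\<theta> / 2)) \<le> 2 / (2 / pi)"
    by (intro divide_left_mono[OF *] mult_pos_pos[of _ "2 / pi"]) auto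
  then show ?thesis
    using sine_sum_approx[OF th assms(2), of N] pi_less_4 by simp
qed

text \<open>Periodicity moves the argument into one period, and the antisymmetry of both functions
  about \<open>pi\<close> folds it into \<open>[0, pi]\<close>. The value \<open>\<eta> = 0\<close>
  arises only from multiples of \<open>2 * pi\<close>.\<close>

lemma sawtooth_error_cases:
  obtains \<eta> where "0 \<le> \<eta>" "\<eta> \<le> pi"
    "\<And>N. sawtooth_error N \<theta> = \<bar>sine_sum N \<eta> - (pi - \<eta>) / 2\<bar>"
    "\<theta> / (2 * pi) \<notin> \<int> \<Longrightarrow> 0 < \<eta>"
proof -
  define m where "m = \<lfloor>\<theta> / (2 * pi)\<rfloor>"
  define \<theta>' where "\<theta>' = \<theta> - 2 * pi * of_int m"
  have eq: "\<theta> = \<theta>' + 2 * pi * of_int m" by (simp add: \<theta>'_def)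
  have fl: "of_int m \<le> \<theta> / (2 * pi)" "\<theta> / (2 * pi) < of_int m + 1"
    by (auto simp: m_def)
  have b: "0 \<le> \<theta>'" "\<theta>' < 2 * pi"
    using fl by (auto simp: \<theta>'_def field_simps)
  have pos: "0 < \<theta>'" if "\<theta> / (2 * pi) \<notin> \<int>"
  proof -
    have "\<theta>' \<noteq> 0"
    proof
      assume "\<theta>' = 0"
      then have "\<theta> / (2 * pi) = of_int m" by (simp add: eq)
      then show False using that by simp
    qed
    then show ?thesis using b by simp
  qed
  have err: "sawtooth_error N \<theta> = \<bar>sine_sum N \<theta>' - (pi - \<theta>') / 2\<bar>" for N
    unfolding sawtooth_error_def eq sine_sum_periodic sawtooth_periodic sawtooth_eq[OF b] ..
  show ?thesis
  proof (cases "\<theta>' \<le> pi")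
    case True
    then show ?thesis using that[of \<theta>'] b pos err by blast
  next
    case False
    have "sine_sum N (2 * pi - \<theta>') = - sine_sum N \<theta>'" for N
      using sine_sum_periodic[of N "- \<theta>'" 1] by (simp add: sine_sum_minus algebra_simps)
    then have "sawtooth_error N \<theta> = \<bar>sine_sum N (2 * pi - \<theta>') - (pi - (2 * pi - \<theta>')) / 2\<bar>" for N
      unfolding err by (simp add: abs_if field_simps)
    then show ?thesis using that[of "2 * pi - \<theta>'"] b False by simp
  qed
qed

lemma sawtooth_error_bounded: "sawtooth_error N \<theta> \<le> 4"
  using sawtooth_error_cases[of \<theta>] sawtooth_error_bounded_aux by metis

lemma sawtooth_error_tendsto_0:
  assumes "\<theta> / (2 * pi) \<notin> \<int>"
  shows "(\<lambda>N. sawtooth_error N \<theta>) \<longlonglongrightarrow> 0"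
proof -
  obtain \<eta> where \<eta>: "0 < \<eta>" "\<eta> \<le> pi"
    and err: "\<And>N. sawtooth_error N \<theta> = \<bar>sine_sum N \<eta> - (pi - \<eta>) / 2\<bar>"
    using sawtooth_error_cases[of \<theta>] assms by metis
  have pos: "sin (\<eta> / 2) > 0"
    using \<eta> by (intro sin_gt_zero) auto
  show ?thesis
  proof (rule tendsto_sandwich[of "\<lambda>_. 0"])
    show "\<forall>\<^sub>F N in sequentially. sawtooth_error N \<theta> \<le> 2 / ((2 * real N + 1) * sin (\<eta> / 2))"
      unfolding err using sine_sum_approx[OF \<eta>] by simp
    show "(\<lambda>N. 2 / ((2 * real N + 1) * sin (\<eta> / 2))) \<longlonglongrightarrow> 0"
      using pos by real_asymp
  qed (auto simp: sawtooth_error_def)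
qed

section \<open>The kernel of the COS approximation\<close>

text \<open>The sines come from the product formula for \<open>sin A * cos B\<close>, with arguments
  \<open>A + B\<close> and \<open>A - B\<close>. They are written as \<open>r * (t + s * x)\<close>
  with \<open>s\<close> equal to 1 or -1, to fit \<open>integral_sawtooth_error_le\<close>. The
  bound \<open>b\<close> does not clip \<open>y\<close> here, so the kernel represents
  \<open>H_COS\<close> for \<open>a < y \<le> b\<close>.\<close>

definition COS_kernel :: "real \<Rightarrow> real \<Rightarrow> nat \<Rightarrow> real \<Rightarrow> real \<Rightarrow> real" where
  "COS_kernel a b N y x = (y - a) / (b - a) +
     (sine_sum N (pi / (b - a) * ((y - 2 * a) + x)) + sine_sum N (pi / (b - a) * (y - x))) / pi"

definition COS_limit_kernel :: "real \<Rightarrow> real \<Rightarrow> real \<Rightarrow> real \<Rightarrow> real" where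
  "COS_limit_kernel a b y x = (y - a) / (b - a) +
     (sawtooth (pi / (b - a) * ((y - 2 * a) + x)) + sawtooth (pi / (b - a) * (y - x))) / pi"

text \<open>The linear parts of the two sawtooths add up to \<open>- pi * (y - a) / (b - a)\<close>
  and cancel the leading term of the kernel; what is left is an integer.\<close>

lemma COS_limit_kernel_eq:
  assumes "a < b"
  shows "COS_limit_kernel a b y x =
    of_int (1 + \<lfloor>(y - a) / (2 * (b - a)) + (x - a) / (2 * (b - a))\<rfloor>
              + \<lfloor>(y - a) / (2 * (b - a)) - (x - a) / (2 * (b - a))\<rfloor>)"
proof -
  have w: "b - a > 0" using assms by simp
  have 1: "pi / w * ((y - 2 * a) + x) / (2 * pi) = (y - a) / (2 * w) + (x - a) / (2 * w)"
    and 2: "pi / w * (y - x) / (2 * pi) = (y - a) / (2 * w) - (x - a) / (2 * w)"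
    and 3: "pi / w * ((y - 2 * a) + x) / 2 + pi / w * (y - x) / 2 = pi * ((y - a) / w)"
    if "w > 0" for w
    using that by (simp_all add: divide_simps algebra_simps)
  have "sawtooth (pi / (b - a) * ((y - 2 * a) + x)) + sawtooth (pi / (b - a) * (y - x)) =
     pi * (1 - (y - a) / (b - a) +
     of_int (\<lfloor>(y - a) / (2 * (b - a)) + (x - a) / (2 * (b - a))\<rfloor>
              + \<lfloor>(y - a) / (2 * (b - a)) - (x - a) / (2 * (b - a))\<rfloor>))"
    unfolding sawtooth_def 1[OF w] 2[OF w] using 3[OF w] by (simp add: algebra_simps)
  then show ?thesis
    unfolding COS_limit_kernel_def by simp
qed

text \<open>The arguments sum to \<open>2 * p\<close>, which lies strictly between 0 and 1, and two
  floors lose less than 2 in total.\<close>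

lemma floor_add_floor_diff_cases:
  fixes p q :: real
  assumes "0 < p" "p < 1 / 2"
  shows "\<lfloor>p + q\<rfloor> + \<lfloor>p - q\<rfloor> \<in> {-1, 0}"
proof -
  have "of_int \<lfloor>p + q\<rfloor> \<le> p + q" "p + q < of_int \<lfloor>p + q\<rfloor> + 1"
    "of_int \<lfloor>p - q\<rfloor> \<le> p - q" "p - q < of_int \<lfloor>p - q\<rfloor> + 1" by linarith+
  then have "of_int (\<lfloor>p + q\<rfloor> + \<lfloor>p - q\<rfloor>) < (1::real)" "of_int (\<lfloor>p + q\<rfloor> + \<lfloor>p - q\<rfloor>) > (-2::real)"
    using assms unfolding of_int_add by linarith+
  then show ?thesis by auto
qed

text \<open>Here \<open>x\<close> is arbitrary: the bound outside \<open>(a, b)\<close> is what lets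
  the error be counted by the mass out there.\<close>

lemma COS_limit_kernel_range:
  assumes "a < y" "y < b"
  shows "COS_limit_kernel a b y x \<in> {0, 1}"
proof -
  have "0 < (y - a) / (2 * (b - a))" "(y - a) / (2 * (b - a)) < 1 / 2"
    using assms by (auto simp: field_simps)
  from floor_add_floor_diff_cases[OF this, of "(x - a) / (2 * (b - a))"] show ?thesis
    using assms by (subst COS_limit_kernel_eq) auto
qed

lemma COS_limit_kernel_inside:
  assumes "a < y" "y < b" "a < x" "x < b"
  shows "COS_limit_kernel a b y x = indicator {..y} x"
proof -
  define p q where "p = (y - a) / (2 * (b - a))" and "q = (x - a) / (2 * (b - a))"
  have b: "0 < p" "p < 1/2" "0 < q" "q < 1/2"
    using assms by (auto simp: p_def q_def field_simps)
  have "x \<le> y \<longleftrightarrow> q \<le> p"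
    using assms by (auto simp: p_def q_def divide_simps)
  moreover have "\<lfloor>p + q\<rfloor> = 0" using b by (simp add: floor_eq_iff)
  moreover have "\<lfloor>p - q\<rfloor> = (if q \<le> p then 0 else -1)"
    using b by (auto simp: floor_eq_iff)
  ultimately show ?thesis
    unfolding COS_limit_kernel_eq[OF less_trans[OF assms(1,2)]] p_def[symmetric] q_def[symmetric]
    by (simp add: indicator_def)
qed

section \<open>Expectations of the kernels\<close>

context real_distribution
begin

text \<open>The phase factor shifts the argument of the exponential by \<open>a\<close>. The
  expectation runs over the whole line and so includes the mass outside
  \<open>(a, b)\<close>.\<close>

lemma COS_coeff_char:
  assumes "a < b"
  shows "COS_coeff (char M) a b k = 2 / (b - a) * (\<integral>x. cos (real k * pi * (x - a) / (b - a)) \<partial>M)"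
proof -
  define u where "u = real k * pi / (b - a)"
  define v where "v = real k * a * pi / (b - a)"
  have uv: "u * x - v = real k * pi * (x - a) / (b - a)" for x
    by (simp add: u_def v_def diff_divide_distrib algebra_simps)
  have int: "integrable M (\<lambda>x. iexp (u * x))"
    by (intro integrable_iexp) auto
  have "char M u * exp (- \<i> * complex_of_real v) = (CLINT x|M. iexp (u * x) * exp (- \<i> * complex_of_real v))"
    unfolding char_def by simp
  then have "Re (char M u * exp (- \<i> * complex_of_real v)) = (\<integral>x. Re (iexp (u * x) * exp (- \<i> * complex_of_real v)) \<partial>M)"
    by (simp only:) (intro integral_Re[symmetric] integrable_mult_left int)
  also have "\<dots> = (\<integral>x. cos (u * x - v) \<partial>M)"
  proof (intro Bochner_Integration.integral_cong refl)
    fix x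
    have "iexp (u * x) * exp (- \<i> * complex_of_real v) = iexp (u * x - v)"
      by (simp add: exp_add[symmetric] algebra_simps)
    then show "Re (iexp (u * x) * exp (- \<i> * complex_of_real v)) = cos (u * x - v)"
      by (simp only: Re_exp) simp
  qed
  finally show ?thesis
    unfolding COS_coeff_def uv by (simp add: u_def v_def)
qed

lemma integrable_bounded:
  fixes g :: "real \<Rightarrow> real"
  assumes "g \<in> borel_measurable borel" "\<And>x. \<bar>g x\<bar> \<le> B"
  shows "integrable M g"
  using assms by (intro integrable_const_bound[of _ B]) auto

lemma H_COS_char:
  assumes "a < y" "y \<le> b"
  shows "H_COS (char M) a b N y = (\<integral>x. COS_kernel a b N y x \<partial>M)"
proof -
  have ab: "a < b" using assms by simp
  have c0: "COS_coeff (char M) a b 0 = 2 / (b - a)"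
    by (simp add: COS_coeff_def char_zero)
  define g where "g = (\<lambda>k x. (sin (real k * (pi / (b - a) * ((y - 2 * a) + x))) / real k +
          sin (real k * (pi / (b - a) * (y - x))) / real k) / pi)"
  have int: "integrable M (g k)" for k
    unfolding g_def
    by (intro Bochner_Integration.integrable_add integrable_divide integrable_bounded[of _ 1]) auto
  have k: "COS_coeff (char M) a b k * ((b - a) / (real k * pi)) * sin (real k * pi * ((y - a) / (b - a)))
     = (\<integral>x. g k x \<partial>M)" if "k \<in> {1..N}" for k
  proof -
    have k0: "real k \<noteq> 0" using that by auto
    have "COS_coeff (char M) a b k * ((b - a) / (real k * pi)) * sin (real k * pi * ((y - a) / (b - a)))
      = (2 / (real k * pi) * sin (real k * pi * ((y - a) / (b - a)))) * (\<integral>x. cos (real k * pi * (x - a) / (b - a)) \<partial>M)"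
      using ab by (simp add: COS_coeff_char)
    also have "\<dots> = (\<integral>x. (2 / (real k * pi) * sin (real k * pi * ((y - a) / (b - a)))) * cos (real k * pi * (x - a) / (b - a)) \<partial>M)"
      by simp
    also have "\<dots> = (\<integral>x. g k x \<partial>M)"
    proof (intro Bochner_Integration.integral_cong refl)
      fix x
      define A where "A = real k * pi * ((y - a) / (b - a))"
      define B where "B = real k * pi * (x - a) / (b - a)"
      have "r * (pi / w * ((y - 2 * a) + x)) = r * pi * ((y - a) / w) + r * pi * (x - a) / w"
        "r * (pi / w * (y - x)) = r * pi * ((y - a) / w) - r * pi * (x - a) / w" if "w > 0" for r w
        using that by (simp_all add: divide_simps algebra_simps)
      from this[of "b - a" "real k"]
      have AB: "real k * (pi / (b - a) * ((y - 2 * a) + x)) = A + B" "real k * (pi / (b - a) * (y - x)) = A - B"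
        using ab by (simp_all add: A_def B_def)
      \<comment> \<open>Uses \<open>2 * sin A * cos B = sin (A + B) + sin (A - B)\<close>.\<close>
      have "2 / (real k * pi) * sin A * cos B = g k x"
        unfolding g_def AB using k0 by (simp add: sin_add sin_diff field_simps)
      then show "2 / (real k * pi) * sin (real k * pi * ((y - a) / (b - a))) * cos (real k * pi * (x - a) / (b - a)) = g k x"
        by (simp add: A_def B_def)
    qed
    finally show ?thesis .
  qed
  have "COS_kernel a b N y x = (y - a) / (b - a) + (\<Sum>k=1..N. g k x)" for x
    unfolding COS_kernel_def sine_sum_def g_def
    by (simp add: sum.distrib sum_divide_distrib add_divide_distrib)
  then have "(\<integral>x. COS_kernel a b N y x \<partial>M) = (\<integral>x. (y - a) / (b - a) + (\<Sum>k=1..N. g k x) \<partial>M)"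
    by simp
  also have "\<dots> = (y - a) / (b - a) + (\<Sum>k=1..N. \<integral>x. g k x \<partial>M)"
    using int by (simp add: prob_space del: space_eq_univ)
  also have "(y - a) / (b - a) = COS_coeff (char M) a b 0 / 2 * (y - a)"
  proof -
    have "z / w = 2 / w / 2 * z" for z w :: real by simp
    then show ?thesis unfolding c0 .
  qed
  also have "COS_coeff (char M) a b 0 / 2 * (y - a) + (\<Sum>k=1..N. \<integral>x. g k x \<partial>M) = H_COS (char M) a b N y"
    using assms k by (simp add: H_COS_def)
  finally show ?thesis ..
qed

text \<open>Every sine is taken at a multiple of \<open>pi\<close>, so only the zeroth term remains,
  and it is 1 because the characteristic function is 1 at 0.\<close>

lemma H_COS_beyond:
  assumes "a < b" "b \<le> y"
  shows "H_COS (char M) a b N y = 1"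
proof -
  have "sin (real k * pi * ((b - a) / (b - a))) = 0" for k
    using assms by simp
  then show ?thesis
    using assms by (simp add: H_COS_def COS_coeff_def char_zero min_absorb2)
qed

text \<open>Kernel and indicator agree on \<open>(a, b)\<close> and differ by at most 1
  elsewhere.\<close>

lemma COS_limit_kernel_integral:
  assumes "a < y" "y < b"
  shows "\<bar>(\<integral>x. COS_limit_kernel a b y x \<partial>M) - cdf M y\<bar> \<le> prob (- {a<..<b})"
proof -
  have [measurable]: "COS_limit_kernel a b y \<in> borel_measurable borel"
    unfolding COS_limit_kernel_def by measurable
  have int: "integrable M (COS_limit_kernel a b y)"
    using COS_limit_kernel_range[OF assms] by (intro integrable_bounded[of _ 1]) (auto, smt)
  have int2: "integrable M (indicator {..y} :: real \<Rightarrow> real)"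
    by (intro integrable_bounded[of _ 1]) (auto split: split_indicator)
  have int3: "integrable M (indicator (- {a<..<b}) :: real \<Rightarrow> real)"
    by (intro integrable_bounded[of _ 1]) (auto split: split_indicator)
  have "\<bar>(\<integral>x. COS_limit_kernel a b y x \<partial>M) - cdf M y\<bar> =
     \<bar>\<integral>x. COS_limit_kernel a b y x - indicator {..y} x \<partial>M\<bar>"
    using int int2 by (simp add: cdf_def)
  also have "\<dots> \<le> (\<integral>x. \<bar>COS_limit_kernel a b y x - indicator {..y} x\<bar> \<partial>M)"
    by (rule integral_abs_bound)
  also have "\<dots> \<le> (\<integral>x. indicator (- {a<..<b}) x \<partial>M)"
  proof (rule integral_mono)
    fix x
    show "\<bar>COS_limit_kernel a b y x - indicator {..y} x\<bar> \<le> indicator (- {a<..<b}) x"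
      using COS_limit_kernel_range[OF assms, of x] COS_limit_kernel_inside[OF assms, of x]
      by (cases "a < x \<and> x < b") (auto split: split_indicator)
  qed (use int int2 int3 in auto)
  also have "\<dots> = prob (- {a<..<b})" by simp
  finally show ?thesis .
qed

lemma COS_kernel_integral_diff:
  "\<bar>(\<integral>x. COS_kernel a b N y x \<partial>M) - (\<integral>x. COS_limit_kernel a b y x \<partial>M)\<bar> \<le>
    (\<integral>x. sawtooth_error N (pi / (b - a) * ((y - 2 * a) + x)) \<partial>M) +
    (\<integral>x. sawtooth_error N (pi / (b - a) * (y - x)) \<partial>M)"
  (is "_ \<le> integral\<^sup>L M ?e1 + integral\<^sup>L M ?e2")
proof -
  have [measurable]: "COS_limit_kernel a b y \<in> borel_measurable borel" "COS_kernel a b N y \<in> borel_measurable borel"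
    unfolding COS_limit_kernel_def COS_kernel_def by measurable
  have e: "integrable M ?e1" "integrable M ?e2"
    by (intro integrable_bounded[of _ 4]; use sawtooth_error_bounded in \<open>auto simp: sawtooth_error_def\<close>)+
  have le: "\<bar>COS_kernel a b N y x - COS_limit_kernel a b y x\<bar> \<le> ?e1 x + ?e2 x" for x
  proof -
    have "COS_kernel a b N y x - COS_limit_kernel a b y x =
       ((sine_sum N (pi / (b - a) * ((y - 2 * a) + x)) - sawtooth (pi / (b - a) * ((y - 2 * a) + x))) +
        (sine_sum N (pi / (b - a) * (y - x)) - sawtooth (pi / (b - a) * (y - x)))) / pi"
      unfolding COS_kernel_def COS_limit_kernel_def by (simp add: field_simps)
    then have "\<bar>COS_kernel a b N y x - COS_limit_kernel a b y x\<bar> \<le> (?e1 x + ?e2 x) / pi"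
      unfolding sawtooth_error_def by (auto simp: abs_divide intro!: divide_right_mono)
    also have "\<dots> \<le> (?e1 x + ?e2 x) / 1"
      using pi_gt3 by (intro divide_left_mono) (auto simp: sawtooth_error_def)
    finally show ?thesis by simp
  qed
  have K: "integrable M (COS_kernel a b N y)"
  proof (rule integrable_bounded)
    fix x
    have "\<bar>sine_sum N (pi / (b - a) * ((y - 2 * a) + x)) + sine_sum N (pi / (b - a) * (y - x))\<bar> \<le> real N + real N"
      by (intro order.trans[OF abs_triangle_ineq] add_mono sine_sum_bounded)
    then show "\<bar>COS_kernel a b N y x\<bar> \<le> \<bar>(y - a) / (b - a)\<bar> + (real N + real N) / pi"
      unfolding COS_kernel_def
      by (intro order.trans[OF abs_triangle_ineq] add_left_mono)
        (simp only: abs_divide abs_of_pos[OF pi_gt_zero], intro divide_right_mono, auto)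
  qed simp
  have D: "integrable M (\<lambda>x. COS_kernel a b N y x - COS_limit_kernel a b y x)"
  proof (rule Bochner_Integration.integrable_bound[OF Bochner_Integration.integrable_add[OF e]])
    show "AE x in M. norm (COS_kernel a b N y x - COS_limit_kernel a b y x) \<le> norm (?e1 x + ?e2 x)"
      unfolding real_norm_def by (intro AE_I2 order.trans[OF le abs_ge_self])
  qed simp
  have L: "integrable M (COS_limit_kernel a b y)"
    using Bochner_Integration.integrable_diff[OF K D] by simp
  have "\<bar>(\<integral>x. COS_kernel a b N y x \<partial>M) - (\<integral>x. COS_limit_kernel a b y x \<partial>M)\<bar>
    = \<bar>\<integral>x. COS_kernel a b N y x - COS_limit_kernel a b y x \<partial>M\<bar>"
    using K L by simp
  also have "\<dots> \<le> (\<integral>x. \<bar>COS_kernel a b N y x - COS_limit_kernel a b y x\<bar> \<partial>M)"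
    by (rule integral_abs_bound)
  also have "\<dots> \<le> (\<integral>x. ?e1 x + ?e2 x \<partial>M)"
    by (rule integral_mono) (use D e le in auto)
  also have "\<dots> = integral\<^sup>L M ?e1 + integral\<^sup>L M ?e2"
    by (rule Bochner_Integration.integral_add[OF e])
  finally show ?thesis .
qed

end

section \<open>Uniform error bounds for exponentially decaying densities\<close>

text \<open>The half-line integral for \<open>c = 1\<close> is the Gamma integral
  \<open>fact k\<close>; evenness extends it to the line and the substitution \<open>c * x\<close>
  gives general \<open>c\<close>.\<close>

lemma integrable_abs_power_exp:
  fixes c :: real
  assumes "c > 0"
  shows "integrable lborel (\<lambda>x. \<bar>x\<bar> ^ k * exp (- c * \<bar>x\<bar>))"
proof -
  have "has_bochner_integral lborel (\<lambda>x::real. indicator {0..} x *\<^sub>R (\<bar>x\<bar> ^ k * exp (- \<bar>x\<bar>))) (fact k)"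
  proof (rule has_bochner_integral_cong[THEN iffD1, OF refl _ refl has_bochner_integral_I0i_power_exp_m'])
    show "x ^ k * exp (- x) * indicator {0..} x = indicator {0..} x *\<^sub>R (\<bar>x\<bar> ^ k * exp (- \<bar>x\<bar>))" for x :: real
      by (simp split: split_indicator)
  qed
  then have "integrable lborel (\<lambda>x::real. \<bar>x\<bar> ^ k * exp (- \<bar>x\<bar>))"
    by (intro integrable.intros[OF has_bochner_integral_even_function]) auto
  from lborel_integrable_real_affine[OF this, of c 0]
  have "integrable lborel (\<lambda>x. inverse (c ^ k) * (\<bar>c * x\<bar> ^ k * exp (- \<bar>c * x\<bar>)))"
    using assms by simp
  moreover have "inverse (c ^ k) * (\<bar>c * x\<bar> ^ k * exp (- \<bar>c * x\<bar>)) = \<bar>x\<bar> ^ k * exp (- c * \<bar>x\<bar>)" for x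
    using assms by (simp add: abs_mult power_mult_distrib)
  ultimately show ?thesis by simp
qed

text \<open>The right-hand side is free of \<open>N\<close> and serves as the majorant for dominated
  convergence.\<close>

lemma exp_sawtooth_error_le:
  "norm (K * exp (- c * \<bar>v\<bar>) * sawtooth_error N (r * v)) \<le> 4 * \<bar>K\<bar> * exp (- c * \<bar>v\<bar>)"
proof -
  have "\<bar>K * exp (- c * \<bar>v\<bar>)\<bar> * sawtooth_error N (r * v) \<le> \<bar>K * exp (- c * \<bar>v\<bar>)\<bar> * 4"
    by (intro mult_left_mono sawtooth_error_bounded) auto
  moreover have "\<bar>sawtooth_error N (r * v)\<bar> = sawtooth_error N (r * v)"
    by (simp add: sawtooth_error_def)
  ultimately show ?thesis
    by (simp add: abs_mult)
qed

lemma integrable_exp_sawtooth_error: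
  assumes "c > 0"
  shows "integrable lborel (\<lambda>v. K * exp (- c * \<bar>v\<bar>) * sawtooth_error N (r * v))"
proof (rule Bochner_Integration.integrable_bound)
  show "integrable lborel (\<lambda>v::real. 4 * \<bar>K\<bar> * exp (- c * \<bar>v\<bar>))"
    using integrable_abs_power_exp[OF assms, of 0] by simp
  show "AE v in lborel. norm (K * exp (- c * \<bar>v\<bar>) * sawtooth_error N (r * v)) \<le> norm (4 * \<bar>K\<bar> * exp (- c * \<bar>v\<bar>))"
    unfolding real_norm_def[of "4 * _ * _"]
    by (intro AE_I2 order.trans[OF exp_sawtooth_error_le abs_ge_self])
qed simp

lemma integral_exp_sawtooth_error_tendsto_0:
  assumes "c > 0" "r > 0"
  shows "(\<lambda>N. \<integral>v. K * exp (- c * \<bar>v\<bar>) * sawtooth_error N (r * v) \<partial>lborel) \<longlonglongrightarrow> 0"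
proof -
  have "(\<lambda>N. \<integral>v. K * exp (- c * \<bar>v\<bar>) * sawtooth_error N (r * v) \<partial>lborel) \<longlonglongrightarrow> (\<integral>v. 0 \<partial>(lborel :: real measure))"
  proof (rule integral_dominated_convergence)
    show "integrable lborel (\<lambda>v::real. 4 * \<bar>K\<bar> * exp (- c * \<bar>v\<bar>))"
      using integrable_abs_power_exp[OF assms(1), of 0] by simp
    show "AE v in lborel. norm (K * exp (- c * \<bar>v\<bar>) * sawtooth_error N (r * v)) \<le> 4 * \<bar>K\<bar> * exp (- c * \<bar>v\<bar>)" for N
      by (intro AE_I2 exp_sawtooth_error_le)
    \<comment> \<open>The points where \<open>r * v\<close> is a multiple of \<open>2 * pi\<close>,
      that is, where the sine series need not converge to the sawtooth.\<close>
    define S where "S = range (\<lambda>m::int. 2 * pi * of_int m / r)"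
    have "S \<in> null_sets lborel"
      unfolding S_def by (intro countable_imp_null_set_lborel) auto
    then have "AE v in lborel. v \<notin> S" by (rule AE_not_in)
    then show "AE v in lborel. (\<lambda>N. K * exp (- c * \<bar>v\<bar>) * sawtooth_error N (r * v)) \<longlonglongrightarrow> 0"
    proof eventually_elim
      case (elim v)
      have "r * v / (2 * pi) \<notin> \<int>"
      proof
        assume "r * v / (2 * pi) \<in> \<int>"
        then obtain m where "r * v / (2 * pi) = of_int m" by (auto elim: Ints_cases)
        then have "v = 2 * pi * of_int m / r" using assms by (simp add: field_simps)
        then show False using elim by (auto simp: S_def)
      qed
      then show ?case
        by (intro tendsto_mult_right_zero sawtooth_error_tendsto_0)
    qed
  qed auto
  then show ?thesis by simp
qed

text \<open>The source of uniformity in \<open>y\<close>: the bound depends on the shift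
  \<open>t\<close> only through \<open>T\<close>. Substituting \<open>v = t + s * x\<close> moves
  the shift into the density, where \<open>\<bar>x\<bar> \<ge> \<bar>v\<bar> - T\<close> turns it
  into the factor \<open>exp (c * T)\<close>.\<close>

lemma integral_sawtooth_error_le:
  fixes f :: "real \<Rightarrow> real"
  assumes [measurable]: "f \<in> borel_measurable borel"
    and nonneg: "\<And>x. 0 \<le> f x" and decay: "\<And>x. f x \<le> C * exp (- c * \<bar>x\<bar>)"
    and "c > 0" and s: "\<bar>s\<bar> = 1" and t: "\<bar>t\<bar> \<le> T"
  shows "(\<integral>x. sawtooth_error N (r * (t + s * x)) \<partial>density lborel f) \<le>
    (\<integral>v. C * exp (c * T) * exp (- c * \<bar>v\<bar>) * sawtooth_error N (r * v) \<partial>lborel)"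
proof -
  have ss: "s * s = 1" "s \<noteq> 0" using s by (auto simp: abs_if split: if_splits)
  have C: "C \<ge> 0"
    using nonneg[of 0] decay[of 0] by simp
  have "(\<integral>x. sawtooth_error N (r * (t + s * x)) \<partial>density lborel f) =
      (\<integral>x. f x * sawtooth_error N (r * (t + s * x)) \<partial>lborel)"
    using nonneg by (subst integral_real_density) auto
  also have "\<dots> = (\<integral>v. f (- s * t + s * v) * sawtooth_error N (r * v) \<partial>lborel)"
  proof -
    \<comment> \<open>Since \<open>s * s = 1\<close>, the inverse substitution is
      \<open>x = - s * t + s * v\<close>, with Jacobian 1.\<close>
    have "t + s * (- s * t + s * v) = v" for v
    proof -
      have "t + s * (- s * t + s * v) = t - (s * s) * t + (s * s) * v" by (simp add: algebra_simps)
      then show ?thesis unfolding ss by simp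
    qed
    then show ?thesis
      using s by (subst lborel_integral_real_affine[OF ss(2), where t = "- s * t"]) simp
  qed
  also have "\<dots> \<le> (\<integral>v. C * exp (c * T) * exp (- c * \<bar>v\<bar>) * sawtooth_error N (r * v) \<partial>lborel)"
  proof (rule integral_mono'[OF integrable_exp_sawtooth_error[OF \<open>c > 0\<close>]])
    fix v
    have "\<bar>v\<bar> - T \<le> \<bar>v - t\<bar>" using t by linarith
    also have "\<bar>v - t\<bar> = \<bar>s\<bar> * \<bar>v - t\<bar>" using s by simp
    also have "\<dots> = \<bar>- s * t + s * v\<bar>" by (simp add: abs_mult[symmetric] algebra_simps)
    finally have "- c * \<bar>- s * t + s * v\<bar> \<le> c * T + - c * \<bar>v\<bar>"
      using \<open>c > 0\<close> mult_left_mono[of "\<bar>v\<bar> - T" "\<bar>- s * t + s * v\<bar>" c] by (simp add: algebra_simps)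
    then have "C * exp (- c * \<bar>- s * t + s * v\<bar>) \<le> C * exp (c * T + - c * \<bar>v\<bar>)"
      using C by (intro mult_left_mono) auto
    then have "f (- s * t + s * v) \<le> C * exp (c * T) * exp (- c * \<bar>v\<bar>)"
      using decay[of "- s * t + s * v"] unfolding exp_add mult.assoc by linarith
    then show "f (- s * t + s * v) * sawtooth_error N (r * v) \<le>
        C * exp (c * T) * exp (- c * \<bar>v\<bar>) * sawtooth_error N (r * v)"
      by (rule mult_right_mono) (simp add: sawtooth_error_def)
    show "0 \<le> C * exp (c * T) * exp (- c * \<bar>v\<bar>) * sawtooth_error N (r * v)"
      using C by (simp add: sawtooth_error_def)
  qed
  finally show ?thesis .
qed

text \<open>For \<open>y\<close> outside \<open>(a, b)\<close> the approximation is exactly 0 or 1,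
  and the outer mass bounds the error. Inside, the gap \<open>\<epsilon> - \<delta>\<close> absorbs
  the two sawtooth errors.\<close>

lemma (in real_distribution) H_COS_error:
  fixes f :: "real \<Rightarrow> real"
  assumes dens: "M = density lborel (\<lambda>x. ennreal (f x))"
    and f: "f \<in> borel_measurable borel" "\<And>x. 0 \<le> f x" "\<And>x. f x \<le> C * exp (- c * \<bar>x\<bar>)" "c > 0"
    and ab: "a < b" and out: "prob (- {a<..<b}) \<le> \<delta>" and "\<delta> < \<epsilon>"
  shows "\<exists>N0. \<forall>N\<ge>N0. \<forall>y. \<bar>H_COS (char M) a b N y - cdf M y\<bar> \<le> \<epsilon>"
proof -
  \<comment> \<open>Bounds both shifts, \<open>y - 2 * a\<close> and \<open>y\<close>, for all
    \<open>y\<close> in \<open>(a, b)\<close>.\<close>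
  define T where "T = 3 * \<bar>a\<bar> + \<bar>b\<bar>"
  define J where "J = (\<lambda>N. \<integral>v. C * exp (c * T) * exp (- c * \<bar>v\<bar>) * sawtooth_error N (pi / (b - a) * v) \<partial>lborel)"
  have "J \<longlonglongrightarrow> 0"
    unfolding J_def using ab f by (intro integral_exp_sawtooth_error_tendsto_0) auto
  moreover have "0 < (\<epsilon> - \<delta>) / 2" using \<open>\<delta> < \<epsilon>\<close> by simp
  ultimately have "\<forall>\<^sub>F N in sequentially. J N < (\<epsilon> - \<delta>) / 2"
    by (rule order_tendstoD)
  then obtain N0 where N0: "\<And>N. N \<ge> N0 \<Longrightarrow> J N < (\<epsilon> - \<delta>) / 2"
    by (auto simp: eventually_sequentially)
  have "\<bar>H_COS (char M) a b N y - cdf M y\<bar> \<le> \<epsilon>" if "N \<ge> N0" for N y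
  proof -
    consider "y \<le> a" | "b \<le> y" | "a < y" "y < b" by linarith
    then show ?thesis
    proof cases
      case 1
      have "cdf M y \<le> prob (- {a<..<b})"
        unfolding cdf_def by (intro finite_measure_mono) (use 1 in auto)
      moreover have "cdf M y \<ge> 0" by (simp add: cdf_def)
      ultimately show ?thesis using 1 out \<open>\<delta> < \<epsilon>\<close> by (simp add: H_COS_def)
    next
      case 2
      have "1 - cdf M y = prob (- {..y})"
        unfolding cdf_def using prob_compl[of "{..y}"] by (simp add: Compl_eq_Diff_UNIV)
      also have "\<dots> \<le> prob (- {a<..<b})"
        by (intro finite_measure_mono) (use 2 in auto)
      finally have "1 - cdf M y \<le> prob (- {a<..<b})" .
      moreover have "cdf M y \<le> 1" by (simp add: cdf_def)
      ultimately show ?thesis using H_COS_beyond[OF ab 2] out \<open>\<delta> < \<epsilon>\<close> by simp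
    next
      case 3
      have "\<bar>y - 2 * a\<bar> \<le> T" "\<bar>y\<bar> \<le> T" using 3 by (auto simp: T_def)
      then have e: "(\<integral>x. sawtooth_error N (pi / (b - a) * ((y - 2 * a) + 1 * x)) \<partial>M) \<le> J N"
          "(\<integral>x. sawtooth_error N (pi / (b - a) * (y + (-1) * x)) \<partial>M) \<le> J N"
        unfolding J_def dens by (intro integral_sawtooth_error_le f; simp)+
      have "\<bar>H_COS (char M) a b N y - (\<integral>x. COS_limit_kernel a b y x \<partial>M)\<bar> \<le> J N + J N"
        using order.trans[OF COS_kernel_integral_diff add_mono[OF e[unfolded mult_1 mult_minus1 add_uminus_conv_diff]]] 3
        by (simp add: H_COS_char)
      moreover have "\<bar>(\<integral>x. COS_limit_kernel a b y x \<partial>M) - cdf M y\<bar> \<le> \<delta>"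
        using COS_limit_kernel_integral[OF 3] out by linarith
      moreover have "J N + J N < \<epsilon> - \<delta>" using N0[OF that] by (simp add: field_simps)
      ultimately show ?thesis by linarith
    qed
  qed
  then show ?thesis by blast
qed

section \<open>Central moments under exponential decay\<close>

lemma (in real_distribution) integrable_shifted_power:
  fixes f :: "real \<Rightarrow> real"
  assumes dens: "M = density lborel (\<lambda>x. ennreal (f x))"
    and f: "f \<in> borel_measurable borel" "\<And>x. 0 \<le> f x" "\<And>x. f x \<le> C * exp (- c * \<bar>x\<bar>)" "c > 0"
  shows "integrable M (\<lambda>x. (x - m) ^ n)"
proof -
  note [measurable] = f(1)
  have "integrable M (\<lambda>x. x ^ k)" for k
  proof -
    have "integrable lborel (\<lambda>x. f x * x ^ k)"
    proof (rule Bochner_Integration.integrable_bound)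
      show "integrable lborel (\<lambda>x. C * (\<bar>x\<bar> ^ k * exp (- c * \<bar>x\<bar>)))"
        using integrable_abs_power_exp[OF f(4)] by simp
      have "norm (f x * x ^ k) \<le> norm (C * (\<bar>x\<bar> ^ k * exp (- c * \<bar>x\<bar>)))" for x
      proof -
        have "f x * \<bar>x\<bar> ^ k \<le> C * exp (- c * \<bar>x\<bar>) * \<bar>x\<bar> ^ k"
          by (intro mult_right_mono f) auto
        then have "f x * \<bar>x\<bar> ^ k \<le> \<bar>C * (\<bar>x\<bar> ^ k * exp (- c * \<bar>x\<bar>))\<bar>"
          by (intro order.trans[OF _ abs_ge_self]) (simp add: mult_ac)
        then show ?thesis
          using f(2)[of x] by (simp add: abs_mult power_abs)
      qed
      then show "AE x in lborel. norm (f x * x ^ k) \<le> norm (C * (\<bar>x\<bar> ^ k * exp (- c * \<bar>x\<bar>)))"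
        by (intro AE_I2)
    qed simp
    then show ?thesis
      unfolding dens using f(2) by (subst integrable_real_density) auto
  qed
  \<comment> \<open>The binomial expansion reduces the shifted power to monomials.\<close>
  then have "integrable M (\<lambda>x. \<Sum>k\<le>n. of_nat (n choose k) * x ^ k * (- m) ^ (n - k))"
    by (intro Bochner_Integration.integrable_sum integrable_mult_left integrable_mult_right)
  then show ?thesis
    using binomial_ring[of _ "- m" n] by simp
qed

text \<open>A vanishing even moment would concentrate the law at \<open>m\<close>, but a law with a
  density has no atoms.\<close>

lemma (in real_distribution) central_moment_pos:
  assumes dens: "M = density lborel (\<lambda>x. ennreal (f x))"
    and [measurable]: "f \<in> borel_measurable borel"
    and int: "integrable M (\<lambda>x. (x - m) ^ n)" and "even n" "n \<noteq> 0"
  shows "(\<integral>x. (x - m) ^ n \<partial>M) > 0"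
proof (rule ccontr)
  assume "\<not> ?thesis"
  moreover have "(\<integral>x. (x - m) ^ n \<partial>M) \<ge> 0"
    using \<open>even n\<close> by (intro integral_nonneg_AE AE_I2 zero_le_even_power)
  ultimately have "(\<integral>x. (x - m) ^ n \<partial>M) = 0" by simp
  then have "AE x in M. (x - m) ^ n = 0"
    using \<open>even n\<close> by (subst (asm) integral_nonneg_eq_0_iff_AE[OF int]) auto
  moreover have "AE x in M. x \<noteq> m"
    unfolding dens using AE_lborel_singleton[of m] by (subst AE_density) auto
  ultimately have "AE x in M. False"
    by eventually_elim (use \<open>n \<noteq> 0\<close> in simp)
  then show False by simp
qed

section \<open>Choice of the truncation interval by Markov's inequality\<close>

theorem theorem2p3:
  fixes M :: "'a measure" and X :: "'a \<Rightarrow> real" and f :: "real \<Rightarrow> real"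
    and \<alpha> \<beta> :: ereal and C1 C2 L0 :: real and n :: nat
  assumes "prob_space M"
    and "distributed M lborel X (\<lambda>x. ennreal (f x))"
    and "\<And>x. f x \<ge> 0"
    and "bounded (range f)"
    and "\<And>x. f x > 0 \<longleftrightarrow> x \<in> einterval \<alpha> \<beta>"
    and "C1 > 0" and "C2 > 0" and "L0 > 0"
    and "\<And>x. \<bar>x\<bar> \<ge> L0 \<Longrightarrow> \<bar>f x\<bar> \<le> C1 * exp (- C2 * \<bar>x\<bar>)"
    and "even n" and "n \<ge> 2"
  defines "\<mu> \<equiv> integral\<^sup>L M X"
    and "F \<equiv> cdf (distr M borel X)"
    and "\<phi> \<equiv> char (distr M borel X)"
  shows "\<exists>\<epsilon>0>0. \<forall>\<epsilon>. 0 < \<epsilon> \<and> \<epsilon> < \<epsilon>0 \<longrightarrow>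
           (\<exists>N0::nat. \<forall>N\<ge>N0.
              let l = root n (2 * (integral\<^sup>L M (\<lambda>\<omega>. (X \<omega> - \<mu>) ^ n)) / \<epsilon>);
                  a = real_of_ereal (max (ereal (\<mu> - l)) \<alpha>);
                  b = real_of_ereal (min (ereal (\<mu> + l)) \<beta>)
              in (SUP y::real. ereal \<bar>H_COS \<phi> a b N y - F y\<bar>) \<le> ereal \<epsilon>)"
proof -
  interpret M: prob_space M by fact
  note f_nonneg = assms(3)
  define P where "P = distr M borel X"
  have [measurable]: "X \<in> borel_measurable M"
    using distributed_measurable[OF assms(2)] by simp
  have f_meas: "f \<in> borel_measurable borel"
    using distributed_real_measurable[OF f_nonneg assms(2)] by simp
  interpret P: real_distribution P
    unfolding P_def by simp
  have dens: "P = density lborel (\<lambda>x. ennreal (f x))"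
    unfolding P_def distributed_distr_eq_density[OF assms(2), symmetric]
    by (rule distr_cong) auto
  obtain B where B: "\<And>x. f x \<le> B"
    using assms(4) by (auto simp: bounded_iff abs_le_iff)
  \<comment> \<open>The second entry makes the exponential bound hold for
    \<open>\<bar>x\<bar> < L0\<close> as well, where \<open>f\<close> is only known to be at most
    \<open>B\<close>.\<close>
  define C where "C = max C1 (B * exp (C2 * L0))"
  have decay: "f x \<le> C * exp (- C2 * \<bar>x\<bar>)" for x
  proof (cases "\<bar>x\<bar> \<ge> L0")
    case True
    have "C1 * exp (- C2 * \<bar>x\<bar>) \<le> C * exp (- C2 * \<bar>x\<bar>)"
      by (intro mult_right_mono) (auto simp: C_def)
    then show ?thesis using assms(9)[OF True] by linarith
  next
    case False
    have "0 \<le> B" using B f_nonneg order.trans by blast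
    have "B * 1 \<le> B * exp (C2 * L0 - C2 * \<bar>x\<bar>)"
      using False \<open>C2 > 0\<close> \<open>0 \<le> B\<close> by (intro mult_left_mono) auto
    also have "\<dots> = B * exp (C2 * L0) * exp (- C2 * \<bar>x\<bar>)"
      by (simp add: exp_diff exp_minus divide_inverse)
    also have "\<dots> \<le> C * exp (- C2 * \<bar>x\<bar>)"
      by (intro mult_right_mono) (auto simp: C_def)
    finally show ?thesis using B[of x] by simp
  qed
  note density_facts = dens f_meas f_nonneg decay \<open>C2 > 0\<close>
  have \<mu>: "\<mu> = (\<integral>x. x \<partial>P)"
    unfolding P_def \<mu>_def by (simp add: integral_distr)
  define m where "m = (\<integral>\<omega>. (X \<omega> - \<mu>) ^ n \<partial>M)"
  have m: "m = (\<integral>x. (x - \<mu>) ^ n \<partial>P)"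
    unfolding P_def m_def by (simp add: integral_distr)
  have int_n: "integrable P (\<lambda>x. (x - \<mu>) ^ n)"
    by (rule P.integrable_shifted_power[OF density_facts])
  have int_1: "integrable P (\<lambda>x. x)"
    using P.integrable_shifted_power[OF density_facts, of 0 1] by simp
  have m_pos: "m > 0"
    unfolding m using assms by (intro P.central_moment_pos[OF dens f_meas int_n]) auto
  have support: "AE x in P. x \<in> einterval \<alpha> \<beta>"
    unfolding dens using f_meas assms(5) by (subst AE_density) auto
  have \<alpha>\<beta>: "\<alpha> < \<beta>"
  proof (rule ccontr)
    assume "\<not> ?thesis"
    then have "einterval \<alpha> \<beta> = {}" by (auto simp: einterval_def)
    then show False using support by simp
  qed
  \<comment> \<open>The mean lies in the closure of the support; together with \<open>l > 0\<close>
    this makes the truncation interval nonempty.\<close>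
  have \<alpha>\<mu>: "\<alpha> \<le> ereal \<mu>"
  proof (cases \<alpha>)
    case (real r)
    have "AE x in P. r \<le> x" using support by eventually_elim (simp add: real einterval_def)
    then show ?thesis unfolding real \<mu> by (simp add: P.integral_ge_const[OF int_1])
  qed (use \<alpha>\<beta> in auto)
  have \<mu>\<beta>: "ereal \<mu> \<le> \<beta>"
  proof (cases \<beta>)
    case (real r)
    have "AE x in P. x \<le> r" using support by eventually_elim (simp add: real einterval_def)
    then show ?thesis unfolding real \<mu> by (simp add: P.integral_le_const[OF int_1])
  qed (use \<alpha>\<beta> in auto)
  have main: "\<exists>N0. \<forall>N\<ge>N0. \<forall>y. \<bar>H_COS \<phi> a b N y - F y\<bar> \<le> \<epsilon>"
    if \<epsilon>: "\<epsilon> > 0" and l: "l = root n (2 * m / \<epsilon>)"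
      and a: "a = real_of_ereal (max (ereal (\<mu> - l)) \<alpha>)"
      and b: "b = real_of_ereal (min (ereal (\<mu> + l)) \<beta>)" for \<epsilon> l a b
  proof -
    have l_pos: "l > 0" unfolding l using \<epsilon> m_pos assms by simp
    have l_pow: "l ^ n = 2 * m / \<epsilon>" unfolding l using \<epsilon> m_pos assms by simp
    \<comment> \<open>The maximum is finite because \<open>\<alpha> < \<beta>\<close> excludes
      \<open>\<alpha> = \<infinity>\<close>, so \<open>real_of_ereal\<close> does not return its
      default value; the same holds for \<open>b\<close>.\<close>
    have ea: "ereal a = max (ereal (\<mu> - l)) \<alpha>"
      unfolding a using \<alpha>\<beta> by (cases \<alpha>) (auto simp: max_def)
    have eb: "ereal b = min (ereal (\<mu> + l)) \<beta>"
      unfolding b using \<alpha>\<beta> by (cases \<beta>) (auto simp: min_def)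
    have "ereal (\<mu> - l) < \<beta>" "\<alpha> < ereal (\<mu> + l)"
      using l_pos \<mu>\<beta> \<alpha>\<mu> by (auto intro: less_le_trans[of _ "ereal \<mu>"] le_less_trans[of _ "ereal \<mu>"])
    then have "ereal a < ereal b"
      unfolding ea eb using \<alpha>\<beta> l_pos by auto
    then have ab: "a < b" by simp
    \<comment> \<open>Almost surely \<open>x\<close> lies in the support, so it can leave
      \<open>(a, b)\<close> only through an end point \<open>\<mu> - l\<close> or
      \<open>\<mu> + l\<close>.\<close>
    have "P.prob (- {a<..<b}) \<le> P.prob {x \<in> space P. (x - \<mu>) ^ n \<ge> l ^ n}"
    proof (rule P.finite_measure_mono_AE)
      show "AE x in P. x \<in> - {a<..<b} \<longrightarrow> x \<in> {x \<in> space P. (x - \<mu>) ^ n \<ge> l ^ n}"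
        using support
      proof eventually_elim
        case (elim x)
        have "l \<le> \<bar>x - \<mu>\<bar>" if "x \<notin> {a<..<b}"
        proof -
          have "ereal x \<le> ereal a \<or> ereal b \<le> ereal x" using that by auto
          then have "x \<le> \<mu> - l \<or> \<mu> + l \<le> x"
            using elim unfolding ea eb by (auto simp: einterval_def le_max_iff_disj min_le_iff_disj)
          then show ?thesis by linarith
        qed
        then have "l ^ n \<le> \<bar>x - \<mu>\<bar> ^ n" if "x \<notin> {a<..<b}"
          using that l_pos by (intro power_mono) auto
        then show ?case using \<open>even n\<close> by (auto simp: power_even_abs)
      qed
    qed auto
    also have "\<dots> \<le> m / l ^ n"
      unfolding m using int_n l_pos \<open>even n\<close>
      by (intro integral_Markov_inequality_measure[where A = "{}"]) auto
    \<comment> \<open>The factor 2 in \<open>l\<close> leaves the other half of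
      \<open>\<epsilon>\<close> for the series error.\<close>
    also have "\<dots> = \<epsilon> / 2" unfolding l_pow using \<epsilon> m_pos by simp
    finally have "P.prob (- {a<..<b}) \<le> \<epsilon> / 2" .
    from P.H_COS_error[OF density_facts ab this, of \<epsilon>] show ?thesis
      unfolding \<phi>_def F_def P_def[symmetric] using \<epsilon> by simp
  qed
  show ?thesis
  \<comment> \<open>Any positive witness would do, as \<open>main\<close> covers every
    \<open>\<epsilon> > 0\<close>.\<close>
  proof (rule exI[of _ 1], intro conjI allI impI)
    fix \<epsilon> :: real assume \<epsilon>: "0 < \<epsilon> \<and> \<epsilon> < 1"
    define l where "l = root n (2 * m / \<epsilon>)"
    define a where "a = real_of_ereal (max (ereal (\<mu> - l)) \<alpha>)"
    define b where "b = real_of_ereal (min (ereal (\<mu> + l)) \<beta>)"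
    obtain N0 where N0: "\<And>N y. N \<ge> N0 \<Longrightarrow> \<bar>H_COS \<phi> a b N y - F y\<bar> \<le> \<epsilon>"
      using main[OF _ l_def a_def b_def] \<epsilon> by blast
    show "\<exists>N0::nat. \<forall>N\<ge>N0.
              let l = root n (2 * (integral\<^sup>L M (\<lambda>\<omega>. (X \<omega> - \<mu>) ^ n)) / \<epsilon>);
                  a = real_of_ereal (max (ereal (\<mu> - l)) \<alpha>);
                  b = real_of_ereal (min (ereal (\<mu> + l)) \<beta>)
              in (SUP y::real. ereal \<bar>H_COS \<phi> a b N y - F y\<bar>) \<le> ereal \<epsilon>"
      unfolding Let_def m_def[symmetric] l_def[symmetric] a_def[symmetric] b_def[symmetric]
      using N0 by (intro exI[of _ N0] allI impI SUP_least) simp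
  qed simp
qed

end
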